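(* Let $N\ge 2$ and $\mathbf{K}^\dagger=(K_1^\dagger,\dots,K_N^\dagger)\in\mathcal{K}$. For an admissible family of cost parameters $(\{Q_i\}_{i\in\mathcal{N}},\{R_{ij}\}_{i,j\in\mathcal{N}})$ consider the identity (of polynomial matrices in $s$) $$(\ast)_i\qquad \tilde D_i'(-s)R_{ii}\tilde D_i(s)=D_i'(-s)R_{ii}D_i(s)+S_i'(-s)\Big(Q_i+\sum_{j\ne i}{K_j^\dagger}'R_{ij}K_j^\dagger\Big)S_i(s).$$ (1) Suppose there exist admissible $\{\tilde Q_i\}_{i\in\mathcal{N}}$ and $\{\tilde R_{ij}\}_{i,j\in\mathcal{N}}$, with $\tilde R_{ij}$ non-zero for some $i\ne j$, such that $(\ast)_i$ holds for every $i\in\mathcal{N}$. Then there exist admissible $\{\bar Q_i\}_{i\in\mathcal{N}}$ and $\{\bar R_{ij}\}_{i,j\in\mathcal{N}}$, with $\bar R_{ij}=0$ for all $i\ne j$, such that $(\ast)_i$ holds for every $i\in\mathcal{N}$. (2) Conversely, suppose there exist admissible $\{\bar Q_i\}_{i\in\mathcal{N}}$ with $\bar Q_i\succ 0$ for all $i$ and $\{\bar R_{ij}\}_{i,j\in\mathcal{N}}$ with $\bar R_{ij}=0$ for all $i\ne j$, such that $(\ast)_i$ holds for every $i\in\mathcal{N}$. Then there exist admissible $\{\tilde Q_i\}_{i\in\mathcal{N}}$ and $\{\tilde R_{ij}\}_{i,j\in\mathcal{N}}$, with $\tilde R_{ij}$ non-zero for some $i\ne j$, such that $(\ast)_i$ holds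 for every $i\in\mathcal{N}$.
   Context: Notation: $'$ denotes transpose; $\mathbb{S}_+^n$ (resp. $\mathbb{S}_{++}^n$) is the set of real symmetric positive semidefinite (resp. definite) $n\times n$ matrices. Polynomial matrices have real coefficients; $M'(-s)$ means $(M(-s))'$. Cost parameters $(\{Q_i\},\{R_{ij}\})$ are admissible if $Q_i\in\mathbb{S}_+^n$, $R_{ii}\in\mathbb{S}_{++}^{m_i}$ for all $i$, and $R_{ij}\in\mathbb{S}_+^{m_j}$ for $j\ne i$. Setting: $\mathcal{N}=\{1,\dots,N\}$, $A\in\mathbb{R}^{n\times n}$, $B_i\in\mathbb{R}^{n\times m_i}$ of rank $m_i\ge 1$, coming from the linear system $\dot x=Ax+\sum_iB_iu_i$ with player $i$'s feedback $u_i=-K_ix$, $K_i\in\mathbb{R}^{m_i\times n}$. $\mathcal{K}=\{(K_1,\dots,K_N): A-\sum_iB_iK_i\text{ is Hurwitz}\}$. Define $\tilde A_i^\dagger=A-\sum_{j\ne i}B_jK_j^\dagger$. For each $i$, $(S_i(s),D_i(s))$ is a fixed pair of right-coprime polynomial matrices (sizes $n\times m_i$ and $m_i\times m_i$) with $(sI_n-\tilde A_i^\dagger)^{-1}B_i=S_i(s)D_i(s)^{-1}$ and $D_i(s)$ column reduced (its matrix of leading column coefficients is nonsingular). Set $\tilde D_i(s)=D_i(s)+K_i^\dagger S_i(s)$. *)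

theory Defs
  imports
    "Jordan_Normal_Form.Char_Poly"
    "Jordan_Normal_Form.DL_Rank"
    "HOL-Computational_Algebra.Polynomial_Factorial"
begin

text \<open>
  The dimensions \<open>n\<close> and \<open>m i\<close> vary inside the statement, so matrices are those of
  \<^theory>\<open>Jordan_Normal_Form.Matrix\<close>, with sizes given by \<^const>\<open>carrier_mat\<close>. Families
  indexed by the players \<open>1, \<dots>, N\<close> are functions on \<^typ>\<open>nat\<close> of which only the values
  on \<open>{1..N}\<close> are used.
\<close>

definition psd :: "nat \<Rightarrow> real mat \<Rightarrow> bool" where
  "psd n M \<longleftrightarrow> M \<in> carrier_mat n n \<and> transpose_mat M = M \<and>
     (\<forall>x \<in> carrier_vec n. x \<bullet> (M *\<^sub>v x) \<ge> 0)"

definition pd :: "nat \<Rightarrow> real mat \<Rightarrow> bool" where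
  "pd n M \<longleftrightarrow> M \<in> carrier_mat n n \<and> transpose_mat M = M \<and>
     (\<forall>x \<in> carrier_vec n. x \<noteq> 0\<^sub>v n \<longrightarrow> x \<bullet> (M *\<^sub>v x) > 0)"

definition hurwitz :: "real mat \<Rightarrow> bool" where
  "hurwitz M \<longleftrightarrow> (\<forall>z. eigenvalue (map_mat complex_of_real M) z \<longrightarrow> Re z < 0)"

text \<open>Matrices of varying size are not in class \<^class>\<open>comm_monoid_add\<close>, so a sum over a
  finite index set is taken entrywise, at an explicit size.\<close>

definition msum :: "nat \<Rightarrow> nat \<Rightarrow> (nat \<Rightarrow> 'a::comm_monoid_add mat) \<Rightarrow> nat set \<Rightarrow> 'a mat" where
  "msum nr nc F I = mat nr nc (\<lambda>ij. \<Sum>k\<in>I. F k $$ ij)"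

definition const_pmat :: "real mat \<Rightarrow> real poly mat" where
  "const_pmat M = map_mat (\<lambda>c. [:c:]) M"

text \<open>\<open>para M\<close> is \<open>M'(-s)\<close>: \<open>s\<close> is replaced by \<open>-s\<close> in the transpose of \<open>M\<close>.\<close>

definition para :: "real poly mat \<Rightarrow> real poly mat" where
  "para M = transpose_mat (map_mat (\<lambda>p. pcompose p [:0, -1:]) M)"

text \<open>A square polynomial matrix is unimodular iff it is \<^const>\<open>invertible_mat\<close> over the
  polynomial ring. Right coprime: every common right divisor is unimodular.\<close>

definition right_coprime :: "nat \<Rightarrow> nat \<Rightarrow> real poly mat \<Rightarrow> real poly mat \<Rightarrow> bool" where
  "right_coprime n m S D \<longleftrightarrow>
     (\<forall>S1 \<in> carrier_mat n m. \<forall>D1 \<in> carrier_mat m m. \<forall>U \<in> carrier_mat m m.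
        S = S1 * U \<and> D = D1 * U \<longrightarrow> invertible_mat U)"

definition col_degree :: "real poly mat \<Rightarrow> nat \<Rightarrow> nat" where
  "col_degree M j = Max ((\<lambda>i. degree (M $$ (i, j))) ` {..<dim_row M})"

definition lead_col_coeff_mat :: "real poly mat \<Rightarrow> real mat" where
  "lead_col_coeff_mat M =
     mat (dim_row M) (dim_col M) (\<lambda>(i, j). coeff (M $$ (i, j)) (col_degree M j))"

definition column_reduced :: "real poly mat \<Rightarrow> bool" where
  "column_reduced M \<longleftrightarrow> det (lead_col_coeff_mat M) \<noteq> 0"

text \<open>\<open>(sI - A)\<^sup>-\<^sup>1 B = S D\<^sup>-\<^sup>1\<close> as matrices of rational functions, i.e. over the
  fraction field of the polynomial ring; both inverses are required to exist.
  \<^const>\<open>char_poly_matrix\<close> of \<open>A\<close> is \<open>sI - A\<close>.\<close>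

definition matrix_fraction ::
  "real mat \<Rightarrow> real mat \<Rightarrow> real poly mat \<Rightarrow> real poly mat \<Rightarrow> bool" where
  "matrix_fraction A B S D \<longleftrightarrow>
     (\<exists>P Di. mat_inverse (map_mat to_fract (char_poly_matrix A)) = Some P \<and>
             mat_inverse (map_mat to_fract D) = Some Di \<and>
             P * map_mat to_fract (const_pmat B) = map_mat to_fract S * Di)"

definition stabilizing_gains ::
  "nat \<Rightarrow> nat \<Rightarrow> (nat \<Rightarrow> nat) \<Rightarrow> real mat \<Rightarrow> (nat \<Rightarrow> real mat) \<Rightarrow> (nat \<Rightarrow> real mat) set" where
  "stabilizing_gains N n m A B =
     {K. (\<forall>i\<in>{1..N}. K i \<in> carrier_mat (m i) n) \<and>
         hurwitz (A - msum n n (\<lambda>i. B i * K i) {1..N})}"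

definition A_tilde ::
  "nat \<Rightarrow> nat \<Rightarrow> real mat \<Rightarrow> (nat \<Rightarrow> real mat) \<Rightarrow> (nat \<Rightarrow> real mat) \<Rightarrow> nat \<Rightarrow> real mat" where
  "A_tilde N n A B K i = A - msum n n (\<lambda>j. B j * K j) ({1..N} - {i})"

definition D_tilde ::
  "(nat \<Rightarrow> real mat) \<Rightarrow> (nat \<Rightarrow> real poly mat) \<Rightarrow> (nat \<Rightarrow> real poly mat) \<Rightarrow> nat \<Rightarrow> real poly mat" where
  "D_tilde K S D i = D i + const_pmat (K i) * S i"

definition admissible ::
  "nat \<Rightarrow> nat \<Rightarrow> (nat \<Rightarrow> nat) \<Rightarrow> (nat \<Rightarrow> real mat) \<Rightarrow> (nat \<Rightarrow> nat \<Rightarrow> real mat) \<Rightarrow> bool" where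
  "admissible N n m Q R \<longleftrightarrow>
     (\<forall>i\<in>{1..N}. psd n (Q i) \<and> pd (m i) (R i i) \<and>
        (\<forall>j\<in>{1..N} - {i}. psd (m j) (R i j)))"

definition factorization_identity ::
  "nat \<Rightarrow> nat \<Rightarrow> (nat \<Rightarrow> real mat) \<Rightarrow> (nat \<Rightarrow> real poly mat) \<Rightarrow> (nat \<Rightarrow> real poly mat) \<Rightarrow>
   (nat \<Rightarrow> real mat) \<Rightarrow> (nat \<Rightarrow> nat \<Rightarrow> real mat) \<Rightarrow> nat \<Rightarrow> bool" where
  "factorization_identity N n K S D Q R i \<longleftrightarrow>
     para (D_tilde K S D i) * const_pmat (R i i) * D_tilde K S D i =
       para (D i) * const_pmat (R i i) * D i
       + para (S i)
         * const_pmat (Q i + msum n n (\<lambda>j. transpose_mat (K j) * R i j * K j) ({1..N} - {i}))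
         * S i"

end

theory Submission
  imports Defs
begin

text \<open>
  The identity of player \<open>i\<close> sees the cost parameters only through \<open>R\<^sub>i\<^sub>i\<close> and through the total
  state weight \<open>W\<^sub>i = Q\<^sub>i + \<Sum>\<^bsub>j\<noteq>i\<^esub> K\<^sub>j' R\<^sub>i\<^sub>j K\<^sub>j\<close> (lemma
  \<open>factorization_identity_cong\<close>). Weight may therefore be moved freely between \<open>Q\<^sub>i\<close> and the cross
  terms, as long as admissibility survives.

  For the first claim all cross weight is moved into the state weight: \<open>W\<^sub>i\<close> is positive
  semidefinite (lemma \<open>psd_state_weight\<close>), so it serves as the new \<open>Q\<^sub>i\<close>, with all cross terms set to zero.

  For the second claim a little state weight of player 1 is moved into \<open>R\<^sub>1\<^sub>2\<close>. The choice
  \<open>R\<^sub>1\<^sub>2 = c e e'\<close>, with \<open>e\<close> the first unit vector, contributes \<open>c k k'\<close> to \<open>W\<^sub>1\<close>, where \<open>k\<close> is the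
  first row of \<open>K\<^sub>2\<close> as a column. As \<open>Q\<^sub>1\<close> is positive definite, \<open>Q\<^sub>1 - c k k'\<close> remains positive
  semidefinite for a small \<open>c > 0\<close>; this is the Cauchy--Schwarz inequality for the form
  \<open>Q\<^sub>1\<close>, applied after writing \<open>k = Q\<^sub>1 y\<close> (lemma \<open>pd_minus_outer_psd\<close>).
\<close>

section \<open>The total state weight\<close>

definition state_weight ::
  "nat \<Rightarrow> nat \<Rightarrow> (nat \<Rightarrow> real mat) \<Rightarrow> (nat \<Rightarrow> real mat) \<Rightarrow> (nat \<Rightarrow> nat \<Rightarrow> real mat) \<Rightarrow> nat \<Rightarrow> real mat"
  where
  "state_weight N n K Q R i =
     Q i + msum n n (\<lambda>j. transpose_mat (K j) * R i j * K j) ({1..N} - {i})"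

lemma factorization_identity_cong:
  assumes "R' i i = R i i" and "state_weight N n K Q' R' i = state_weight N n K Q R i"
  shows "factorization_identity N n K S D Q' R' i \<longleftrightarrow> factorization_identity N n K S D Q R i"
  using assms unfolding factorization_identity_def state_weight_def by simp

lemma msum_carrier [simp]: "msum nr nc F I \<in> carrier_mat nr nc"
  by (simp add: msum_def)

lemma msum_zero:
  assumes "\<And>j. j \<in> I \<Longrightarrow> F j = 0\<^sub>m nr nc"
  shows "msum nr nc F I = 0\<^sub>m nr nc"
  unfolding msum_def using assms by (intro eq_matI) (auto intro!: sum.neutral)

lemma msum_single:
  assumes "finite I" and "j \<in> I" and "F j \<in> carrier_mat nr nc"
    and "\<And>k. k \<in> I \<Longrightarrow> k \<noteq> j \<Longrightarrow> F k = 0\<^sub>m nr nc"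
  shows "msum nr nc F I = F j"
proof (rule eq_matI)
  fix a b assume "a < dim_row (F j)" "b < dim_col (F j)"
  then have ab: "a < nr" "b < nc" using assms(3) by auto
  have "(\<Sum>k\<in>I. F k $$ (a, b)) = (\<Sum>k\<in>I. if k = j then F j $$ (a, b) else 0)"
    using assms(4) ab by (intro sum.cong) auto
  then show "msum nr nc F I $$ (a, b) = F j $$ (a, b)"
    using assms(1,2) ab by (simp add: msum_def)
qed (use assms(3) in \<open>auto simp: msum_def\<close>)

section \<open>Positive semidefinite matrices\<close>

lemma quadratic_form_eq_sum:
  fixes M :: "'a::comm_ring_1 mat"
  assumes "M \<in> carrier_mat n n" and "x \<in> carrier_vec n"
  shows "x \<bullet> (M *\<^sub>v x) = (\<Sum>a<n. \<Sum>b<n. x $ a * M $$ (a, b) * x $ b)"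
  using assms
  by (auto simp: scalar_prod_def sum_distrib_left mult.assoc atLeast0LessThan intro!: sum.cong)

lemma psd_msum:
  assumes "\<And>j. j \<in> I \<Longrightarrow> psd n (F j)"
  shows "psd n (msum n n F I)"
proof -
  have "transpose_mat (msum n n F I) = msum n n F I"
  proof (rule eq_matI)
    fix a b assume "a < dim_row (msum n n F I)" "b < dim_col (msum n n F I)"
    then have ab: "a < n" "b < n" by (auto simp: msum_def)
    have "F j $$ (b, a) = F j $$ (a, b)" if "j \<in> I" for j
    proof -
      have c: "F j \<in> carrier_mat n n" and t: "transpose_mat (F j) = F j"
        using assms[OF that] by (auto simp: psd_def)
      have "transpose_mat (F j) $$ (a, b) = F j $$ (b, a)" using c ab by simp
      with t show ?thesis by simp
    qed
    then show "transpose_mat (msum n n F I) $$ (a, b) = msum n n F I $$ (a, b)"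
      using ab by (simp add: msum_def)
  qed (auto simp: msum_def)
  moreover have "x \<bullet> (msum n n F I *\<^sub>v x) \<ge> 0" if x: "x \<in> carrier_vec n" for x
  proof -
    have "x \<bullet> (msum n n F I *\<^sub>v x) = (\<Sum>a<n. \<Sum>b<n. \<Sum>j\<in>I. x $ a * F j $$ (a, b) * x $ b)"
      unfolding quadratic_form_eq_sum[OF msum_carrier x]
      by (intro sum.cong refl) (simp add: msum_def sum_distrib_left sum_distrib_right)
    also have "\<dots> = (\<Sum>a<n. \<Sum>j\<in>I. \<Sum>b<n. x $ a * F j $$ (a, b) * x $ b)"
      by (rule sum.cong[OF refl], rule sum.swap)
    also have "\<dots> = (\<Sum>j\<in>I. \<Sum>a<n. \<Sum>b<n. x $ a * F j $$ (a, b) * x $ b)"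
      by (rule sum.swap)
    also have "\<dots> = (\<Sum>j\<in>I. x \<bullet> (F j *\<^sub>v x))"
      
      using assms x by (intro sum.cong refl quadratic_form_eq_sum[symmetric]) (auto simp: psd_def)
    also have "\<dots> \<ge> 0"
      using assms x by (intro sum_nonneg) (auto simp: psd_def)
    finally show ?thesis .
  qed
  ultimately show ?thesis by (auto simp: psd_def)
qed

lemma psd_zero: "psd n (0\<^sub>m n n)"
  using psd_msum[of "{}" n] by (simp add: msum_def zero_mat_def)

lemma psd_add:
  assumes "psd n P" and "psd n Q"
  shows "psd n (P + Q)"
  using assms
  by (auto simp: psd_def transpose_add add_mult_distrib_mat_vec scalar_prod_add_distrib[of _ n])

lemma psd_congruence:
  assumes R: "psd m R" and K: "K \<in> carrier_mat m n"
  shows "psd n (transpose_mat K * R * K)"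
proof -
  have Rc: "R \<in> carrier_mat m m" and Rt: "transpose_mat R = R" using R by (auto simp: psd_def)
  have "transpose_mat (transpose_mat K * R * K) = transpose_mat K * R * K"
    using K Rc
    by (simp add: transpose_mult[of _ n m _ n] transpose_mult[of _ n m _ m]
        transpose_mult[of _ m m _ n] assoc_mult_mat[of _ n m _ m _ n] Rt)
  moreover have "x \<bullet> (transpose_mat K * R * K *\<^sub>v x) \<ge> 0" if x: "x \<in> carrier_vec n" for x
  proof -
    have Kx: "K *\<^sub>v x \<in> carrier_vec m" using K x by simp
    have RKx: "R *\<^sub>v (K *\<^sub>v x) \<in> carrier_vec m" using Rc Kx by simp
    have "transpose_mat K * R * K *\<^sub>v x = transpose_mat K *\<^sub>v (R *\<^sub>v (K *\<^sub>v x))"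
      using K Rc x
      by (simp add: assoc_mult_mat_vec[of _ n m _ n] assoc_mult_mat_vec[of _ n m _ m])
    then have "x \<bullet> (transpose_mat K * R * K *\<^sub>v x)
        = (transpose_mat K *\<^sub>v (R *\<^sub>v (K *\<^sub>v x))) \<bullet> x"
      using K x RKx by (simp add: comm_scalar_prod[of x n])
    also have "\<dots> = (R *\<^sub>v (K *\<^sub>v x)) \<bullet> (K *\<^sub>v x)"
      by (rule transpose_vec_mult_scalar[OF K x RKx])
    also have "\<dots> = (K *\<^sub>v x) \<bullet> (R *\<^sub>v (K *\<^sub>v x))"
      by (rule comm_scalar_prod[OF RKx Kx])
    finally show ?thesis using R Kx by (simp add: psd_def)
  qed
  ultimately show ?thesis using K Rc by (auto simp: psd_def)
qed

lemma psd_state_weight: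
  assumes adm: "admissible N n m Q R" and i: "i \<in> {1..N}"
    and K: "\<And>j. j \<in> {1..N} \<Longrightarrow> K j \<in> carrier_mat (m j) n"
  shows "psd n (state_weight N n K Q R i)"
  unfolding state_weight_def
proof (intro psd_add psd_msum)
  show "psd n (Q i)" using adm i by (auto simp: admissible_def)
  show "psd n (transpose_mat (K j) * R i j * K j)" if "j \<in> {1..N} - {i}" for j
    using adm i that by (intro psd_congruence[of "m j"] K) (auto simp: admissible_def)
qed

section \<open>Rank-one matrices\<close>

definition outer :: "real \<Rightarrow> real vec \<Rightarrow> real mat" where
  "outer c v = mat (dim_vec v) (dim_vec v) (\<lambda>(a, b). c * v $ a * v $ b)"

lemma outer_carrier: "v \<in> carrier_vec n \<Longrightarrow> outer c v \<in> carrier_mat n n"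
  by (auto simp: outer_def)

lemma transpose_outer: "transpose_mat (outer c v) = outer c v"
  by (intro eq_matI) (auto simp: outer_def)

lemma quadratic_form_outer:
  assumes "v \<in> carrier_vec n" and "x \<in> carrier_vec n"
  shows "x \<bullet> (outer c v *\<^sub>v x) = c * (v \<bullet> x)\<^sup>2"
proof -
  have "x \<bullet> (outer c v *\<^sub>v x) = (\<Sum>a<n. \<Sum>b<n. c * ((v $ a * x $ a) * (v $ b * x $ b)))"
    unfolding quadratic_form_eq_sum[OF outer_carrier[OF assms(1)] assms(2)]
    using assms by (intro sum.cong refl) (simp add: outer_def)
  also have "\<dots> = c * (\<Sum>a<n. v $ a * x $ a)\<^sup>2"
    unfolding power2_eq_square sum_product by (simp only: sum_distrib_left)
  also have "\<dots> = c * (v \<bullet> x)\<^sup>2"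
    using assms by (simp add: scalar_prod_def atLeast0LessThan)
  finally show ?thesis .
qed

lemma psd_outer:
  assumes "v \<in> carrier_vec n" and "c \<ge> 0"
  shows "psd n (outer c v)"
  using assms by (auto simp: psd_def outer_carrier transpose_outer quadratic_form_outer)

lemma congruence_outer:
  assumes K: "K \<in> carrier_mat m n" and v: "v \<in> carrier_vec m"
  shows "transpose_mat K * outer c v * K = outer c (transpose_mat K *\<^sub>v v)"
proof (rule eq_matI)
  fix p q assume "p < dim_row (outer c (transpose_mat K *\<^sub>v v))"
    "q < dim_col (outer c (transpose_mat K *\<^sub>v v))"
  then have pq: "p < n" "q < n" using K by (auto simp: outer_def)
  have "(transpose_mat K * outer c v * K) $$ (p, q)
      = (\<Sum>b<m. (\<Sum>a<m. K $$ (a, p) * (c * v $ a * v $ b)) * K $$ (b, q))"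
    using K v pq
    by (simp add: scalar_prod_def outer_def atLeast0LessThan)
  also have "\<dots> = (\<Sum>b<m. \<Sum>a<m. c * ((K $$ (a, p) * v $ a) * (K $$ (b, q) * v $ b)))"
    by (simp add: sum_distrib_left sum_distrib_right mult_ac)
  also have "\<dots> = (\<Sum>a<m. \<Sum>b<m. c * ((K $$ (a, p) * v $ a) * (K $$ (b, q) * v $ b)))"
    by (rule sum.swap)
  also have "\<dots> = c * (\<Sum>a<m. K $$ (a, p) * v $ a) * (\<Sum>b<m. K $$ (b, q) * v $ b)"
    unfolding mult.assoc[of c] sum_product by (simp only: sum_distrib_left)
  also have "\<dots> = outer c (transpose_mat K *\<^sub>v v) $$ (p, q)"
    using K v pq by (simp add: scalar_prod_def outer_def atLeast0LessThan)
  finally show "(transpose_mat K * outer c v * K) $$ (p, q)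
      = outer c (transpose_mat K *\<^sub>v v) $$ (p, q)" .
qed (use K v in \<open>auto simp: outer_def\<close>)

section \<open>Rank-one perturbation of a positive definite matrix\<close>

lemma pd_imp_psd:
  assumes "pd n Q"
  shows "psd n Q"
  unfolding psd_def
proof (intro conjI ballI)
  show Q: "Q \<in> carrier_mat n n" and "transpose_mat Q = Q" using assms by (auto simp: pd_def)
  fix x :: "real vec" assume x: "x \<in> carrier_vec n"
  show "x \<bullet> (Q *\<^sub>v x) \<ge> 0"
  proof (cases "x = 0\<^sub>v n")
    case True
    then show ?thesis using Q by simp
  next
    case False
    then show ?thesis using assms x by (auto simp: pd_def less_imp_le)
  qed
qed

text \<open>A kernel vector of \<open>Q\<close> would make the quadratic form vanish at a nonzero vector, so \<open>Q\<close> is invertible.\<close>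

lemma pd_surj:
  assumes "pd n Q" and k: "k \<in> carrier_vec n"
  obtains y where "y \<in> carrier_vec n" and "Q *\<^sub>v y = k"
proof -
  have Q: "Q \<in> carrier_mat n n" using assms(1) by (simp add: pd_def)
  have "det Q \<noteq> 0"
  proof
    assume "det Q = 0"
    then obtain x where x: "x \<in> carrier_vec n" "x \<noteq> 0\<^sub>v n" "Q *\<^sub>v x = 0\<^sub>v n"
      using det_0_iff_vec_prod_zero_field[OF Q] by auto
    then have "x \<bullet> (Q *\<^sub>v x) > 0" using assms(1) by (auto simp: pd_def)
    then show False using x by simp
  qed
  from det_non_zero_imp_unit[OF Q this, of "()"]
  obtain P where P: "P \<in> carrier_mat n n" "Q * P = 1\<^sub>m n"
    by (auto simp: Units_def ring_mat_def)
  have "Q *\<^sub>v (P *\<^sub>v k) = k"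
    using assoc_mult_mat_vec[OF Q P(1) k] P(2) k by simp
  with P(1) k show ?thesis by (intro that[of "P *\<^sub>v k"]) auto
qed

text \<open>Expanding the nonnegative number \<open>(x - t y)' Q (x - t y)\<close> gives all that is needed of
  Cauchy--Schwarz, and avoids its degenerate case \<open>y' Q y = 0\<close>.\<close>

lemma psd_two_point:
  assumes Q: "psd n Q" and x: "x \<in> carrier_vec n" and y: "y \<in> carrier_vec n"
  shows "2 * t * ((Q *\<^sub>v y) \<bullet> x) \<le> x \<bullet> (Q *\<^sub>v x) + t\<^sup>2 * (y \<bullet> (Q *\<^sub>v y))"
proof -
  have Qc: "Q \<in> carrier_mat n n" and Qt: "transpose_mat Q = Q" using Q by (auto simp: psd_def)
  have Qx: "Q *\<^sub>v x \<in> carrier_vec n" and Qy: "Q *\<^sub>v y \<in> carrier_vec n" using Qc x y by auto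
  have xy: "x \<bullet> (Q *\<^sub>v y) = (Q *\<^sub>v y) \<bullet> x" by (rule comm_scalar_prod[OF x Qy])
  have yx: "y \<bullet> (Q *\<^sub>v x) = (Q *\<^sub>v y) \<bullet> x"
    using transpose_vec_mult_scalar[OF Qc x y] by (simp add: Qt)
  let ?z = "x + (- t) \<cdot>\<^sub>v y"
  have z: "?z \<in> carrier_vec n" using x y by simp
  have "Q *\<^sub>v ?z = Q *\<^sub>v x + (- t) \<cdot>\<^sub>v (Q *\<^sub>v y)"
    using Qc x y by (simp add: mult_add_distrib_mat_vec mult_mat_vec)
  then have "?z \<bullet> (Q *\<^sub>v ?z)
      = x \<bullet> (Q *\<^sub>v x) - t * (x \<bullet> (Q *\<^sub>v y)) - t * (y \<bullet> (Q *\<^sub>v x) - t * (y \<bullet> (Q *\<^sub>v y)))"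
    using x y Qx Qy
    by (simp add: add_scalar_prod_distrib[of _ n] scalar_prod_add_distrib[of _ n] algebra_simps)
  also have "\<dots> = x \<bullet> (Q *\<^sub>v x) - 2 * t * ((Q *\<^sub>v y) \<bullet> x) + t\<^sup>2 * (y \<bullet> (Q *\<^sub>v y))"
    unfolding xy yx by (simp add: algebra_simps power2_eq_square)
  finally show ?thesis using Q z by (auto simp: psd_def)
qed

text \<open>With \<open>k = Q y\<close> one has \<open>(k \<bullet> x)\<^sup>2 \<le> (y' Q y) (x' Q x)\<close>, so every
  \<open>c > 0\<close> with \<open>c (y' Q y) \<le> 1\<close> will do.\<close>

lemma pd_minus_outer_psd:
  assumes Q: "pd n Q" and k: "k \<in> carrier_vec n"
  obtains c where "c > 0" and "psd n (Q - outer c k)"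
proof -
  have Qc: "Q \<in> carrier_mat n n" and Qt: "transpose_mat Q = Q" using Q by (auto simp: pd_def)
  have Qp: "psd n Q" by (rule pd_imp_psd[OF Q])
  obtain y where y: "y \<in> carrier_vec n" and Qy: "Q *\<^sub>v y = k" using pd_surj[OF Q k] .
  define a where "a = y \<bullet> (Q *\<^sub>v y)"
  have a: "a \<ge> 0" using Qp y by (auto simp: psd_def a_def)
  define c where "c = 1 / (1 + a)"
  have c: "c > 0" "c * a \<le> 1" using a by (auto simp: c_def field_simps)
  have "x \<bullet> ((Q - outer c k) *\<^sub>v x) \<ge> 0" if x: "x \<in> carrier_vec n" for x
  proof -
    let ?b = "k \<bullet> x"
    have "c * ?b\<^sup>2 * (c * a) \<le> c * ?b\<^sup>2 * 1"
      using c by (intro mult_left_mono) auto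
    \<comment> \<open>the parameter \<open>c b\<close> is, up to the 1 in the denominator of \<open>c\<close>, the minimiser \<open>b / a\<close>\<close>
    moreover have "2 * (c * ?b) * ?b \<le> x \<bullet> (Q *\<^sub>v x) + (c * ?b)\<^sup>2 * a"
      using psd_two_point[OF Qp x y, of "c * ?b"] by (simp add: Qy a_def)
    ultimately have "c * ?b\<^sup>2 \<le> x \<bullet> (Q *\<^sub>v x)"
      by (simp add: power2_eq_square algebra_simps)
    moreover have "x \<bullet> ((Q - outer c k) *\<^sub>v x) = x \<bullet> (Q *\<^sub>v x) - c * ?b\<^sup>2"
      using Qc outer_carrier[OF k, of c] x
      by (simp add: minus_mult_distrib_mat_vec scalar_prod_minus_distrib[of _ n]
          flip: quadratic_form_outer[OF k x])
    ultimately show ?thesis by simp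
  qed
  moreover have "transpose_mat (Q - outer c k) = Q - outer c k"
    using Qc outer_carrier[OF k, of c] by (simp add: transpose_minus Qt transpose_outer)
  ultimately have "psd n (Q - outer c k)"
    using Qc outer_carrier[OF k, of c] by (simp add: psd_def minus_carrier_mat)
  with c(1) show ?thesis by (rule that)
qed

section \<open>Exchanging state weight and cross weight\<close>

theorem proposition3:
  fixes N n :: nat and m :: "nat \<Rightarrow> nat"
    and A :: "real mat" and B K :: "nat \<Rightarrow> real mat"
    and S D :: "nat \<Rightarrow> real poly mat"
  assumes "N \<ge> 2"
    and "A \<in> carrier_mat n n"
    and "\<And>i. i \<in> {1..N} \<Longrightarrow> m i \<ge> 1"
    and "\<And>i. i \<in> {1..N} \<Longrightarrow> B i \<in> carrier_mat n (m i)"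
    and "\<And>i. i \<in> {1..N} \<Longrightarrow> vec_space.rank n (B i) = m i"
    and "K \<in> stabilizing_gains N n m A B"
    and "\<And>i. i \<in> {1..N} \<Longrightarrow> S i \<in> carrier_mat n (m i)"
    and "\<And>i. i \<in> {1..N} \<Longrightarrow> D i \<in> carrier_mat (m i) (m i)"
    and "\<And>i. i \<in> {1..N} \<Longrightarrow> right_coprime n (m i) (S i) (D i)"
    and "\<And>i. i \<in> {1..N} \<Longrightarrow> matrix_fraction (A_tilde N n A B K i) (B i) (S i) (D i)"
    and "\<And>i. i \<in> {1..N} \<Longrightarrow> column_reduced (D i)"
  shows
    "((\<exists>Q R. admissible N n m Q R
          \<and> (\<exists>i\<in>{1..N}. \<exists>j\<in>{1..N}. i \<noteq> j \<and> R i j \<noteq> 0\<^sub>m (m j) (m j))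
          \<and> (\<forall>i\<in>{1..N}. factorization_identity N n K S D Q R i))
      \<longrightarrow>
      (\<exists>Q R. admissible N n m Q R
          \<and> (\<forall>i\<in>{1..N}. \<forall>j\<in>{1..N}. i \<noteq> j \<longrightarrow> R i j = 0\<^sub>m (m j) (m j))
          \<and> (\<forall>i\<in>{1..N}. factorization_identity N n K S D Q R i)))
     \<and>
     ((\<exists>Q R. admissible N n m Q R
          \<and> (\<forall>i\<in>{1..N}. pd n (Q i))
          \<and> (\<forall>i\<in>{1..N}. \<forall>j\<in>{1..N}. i \<noteq> j \<longrightarrow> R i j = 0\<^sub>m (m j) (m j))
          \<and> (\<forall>i\<in>{1..N}. factorization_identity N n K S D Q R i))
      \<longrightarrow>
      (\<exists>Q R. admissible N n m Q R
          \<and> (\<exists>i\<in>{1..N}. \<exists>j\<in>{1..N}. i \<noteq> j \<and> R i j \<noteq> 0\<^sub>m (m j) (m j))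
          \<and> (\<forall>i\<in>{1..N}. factorization_identity N n K S D Q R i)))"
proof -
  have K: "K j \<in> carrier_mat (m j) n" if "j \<in> {1..N}" for j
    using assms(6) that by (auto simp: stabilizing_gains_def)
  have cross_zero: "transpose_mat (K j) * 0\<^sub>m (m j) (m j) * K j = 0\<^sub>m n n" if "j \<in> {1..N}" for j
    using K[OF that] by simp
  show ?thesis
  proof (rule conjI; rule impI; elim exE conjE)
    fix Q R
    assume adm: "admissible N n m Q R"
      and fac: "\<forall>i\<in>{1..N}. factorization_identity N n K S D Q R i"
    define Q' where "Q' = state_weight N n K Q R"
    define R' where "R' i j = (if i = j then R i i else 0\<^sub>m (m j) (m j))" for i j
    have Q'_psd: "psd n (Q' i)" if "i \<in> {1..N}" for i
      unfolding Q'_def using adm that K by (rule psd_state_weight)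
    have adm': "admissible N n m Q' R'"
      using adm Q'_psd by (auto simp: admissible_def R'_def psd_zero)
    have "factorization_identity N n K S D Q' R' i" if i: "i \<in> {1..N}" for i
    proof -
      have "msum n n (\<lambda>j. transpose_mat (K j) * R' i j * K j) ({1..N} - {i}) = 0\<^sub>m n n"
        using cross_zero by (intro msum_zero) (auto simp: R'_def)
      then have "state_weight N n K Q' R' i = Q' i"
        using Q'_psd[OF i] by (simp add: state_weight_def psd_def)
      then have "state_weight N n K Q' R' i = state_weight N n K Q R i"
        by (simp add: Q'_def)
      moreover have "R' i i = R i i" by (auto simp: R'_def)
      ultimately show ?thesis using fac i factorization_identity_cong by blast
    qed
    with adm' show "\<exists>Q R. admissible N n m Q R
          \<and> (\<forall>i\<in>{1..N}. \<forall>j\<in>{1..N}. i \<noteq> j \<longrightarrow> R i j = 0\<^sub>m (m j) (m j))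
          \<and> (\<forall>i\<in>{1..N}. factorization_identity N n K S D Q R i)"
      by (intro exI[of _ Q'] exI[of _ R']) (auto simp: R'_def)
  next
    fix Q R
    assume adm: "admissible N n m Q R"
      and Qpd: "\<forall>i\<in>{1..N}. pd n (Q i)"
      and Rz: "\<forall>i\<in>{1..N}. \<forall>j\<in>{1..N}. i \<noteq> j \<longrightarrow> R i j = 0\<^sub>m (m j) (m j)"
      and fac: "\<forall>i\<in>{1..N}. factorization_identity N n K S D Q R i"
    have in12: "1 \<in> {1..N}" "2 \<in> {1..N}" using assms(1) by auto
    define e :: "real vec" where "e = unit_vec (m 2) 0"
    define k where "k = transpose_mat (K 2) *\<^sub>v e"
    have e: "e \<in> carrier_vec (m 2)" by (simp add: e_def)
    have k: "k \<in> carrier_vec n" using K[OF in12(2)] e by (auto simp: k_def)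
    obtain c where c: "c > 0" and Q1: "psd n (Q 1 - outer c k)"
      using pd_minus_outer_psd[OF _ k] Qpd in12 by blast
    define Q' where "Q' = Q(1 := Q 1 - outer c k)"
    define R' where "R' i j = (if i = 1 \<and> j = 2 then outer c e else R i j)" for i j
    have adm': "admissible N n m Q' R'"
      using adm Q1 psd_outer[OF e, of c] c by (auto simp: admissible_def Q'_def R'_def)
    have "outer c e $$ (0, 0) \<noteq> 0\<^sub>m (m 2) (m 2) $$ (0, 0)"
      using assms(3)[OF in12(2)] c by (simp add: outer_def e_def)
    then have nz: "R' 1 2 \<noteq> 0\<^sub>m (m 2) (m 2)" by (auto simp: R'_def)
    have "factorization_identity N n K S D Q' R' i" if i: "i \<in> {1..N}" for i
    proof -
      have "state_weight N n K Q' R' i = state_weight N n K Q R i"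
      proof (cases "i = 1")
        case True
        have Qc: "Q 1 \<in> carrier_mat n n" using Qpd in12 by (auto simp: pd_def)
        have cross: "transpose_mat (K 2) * R' 1 2 * K 2 = outer c k"
          using congruence_outer[OF K[OF in12(2)] e] by (simp add: R'_def k_def)
        have "msum n n (\<lambda>j. transpose_mat (K j) * R' 1 j * K j) ({1..N} - {1})
            = transpose_mat (K 2) * R' 1 2 * K 2"
          using in12 cross outer_carrier[OF k, of c] Rz cross_zero
          by (intro msum_single) (auto simp: R'_def)
        moreover have "msum n n (\<lambda>j. transpose_mat (K j) * R 1 j * K j) ({1..N} - {1}) = 0\<^sub>m n n"
          using in12 Rz cross_zero by (intro msum_zero) auto
        moreover have "Q 1 - outer c k + outer c k = Q 1 + 0\<^sub>m n n"
          using Qc outer_carrier[OF k, of c] by (intro eq_matI) auto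
        ultimately show ?thesis 
          using True by (simp add: state_weight_def Q'_def cross del: One_nat_def)
      next
        case False
        then show ?thesis by (simp add: state_weight_def Q'_def R'_def)
      qed
      moreover have "R' i i = R i i" by (auto simp: R'_def)
      ultimately show ?thesis using fac i factorization_identity_cong by blast
    qed
    with adm' nz in12 show "\<exists>Q R. admissible N n m Q R
          \<and> (\<exists>i\<in>{1..N}. \<exists>j\<in>{1..N}. i \<noteq> j \<and> R i j \<noteq> 0\<^sub>m (m j) (m j))
          \<and> (\<forall>i\<in>{1..N}. factorization_identity N n K S D Q R i)"
      by (intro exI[of _ Q'] exI[of _ R'] conjI bexI[of _ 1] bexI[of _ 2]) auto
  qed
qed

end
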